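(* Let $m$ be a positive integer and let $P^m:C[0,1]\to C[0,1]$ be the $m$-th power operator $P^m(f)=f^m$ (pointwise power) for $f\in C[0,1]$. Then $P^m$ is Fréchet differentiable on $C[0,1]$, and for every $\bar f\in C[0,1]$ the Fréchet derivative $\nabla P^m(\bar f):C[0,1]\to C[0,1]$ satisfies $$\nabla P^m(\bar f)(g)=m\bar f^{\,m-1}g\quad\text{for every } g\in C[0,1].$$
   Context: $C[0,1]$ is the Banach space of real continuous functions on $[0,1]$ with norm $\|f\|_C=\max\{|f(x)|:x\in[0,1]\}$ and origin $\theta_C$. A map $T:C[0,1]\to C[0,1]$ is Fréchet differentiable at $\bar f$ with derivative $\nabla T(\bar f)$ if $\nabla T(\bar f)$ is a continuous linear operator and $\lim_{u\to\theta_C}\frac{T(\bar f+u)-T(\bar f)-\nabla T(\bar f)(u)}{\|u\|_C}=\theta_C$. The convention $f^0\equiv1$ is used. *)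

theory Defs
  imports "HOL-Analysis.Analysis"
begin

typedef unit_interval = "{0..1::real}"
  morphisms real_of_ui ui_of_real
  by (rule exI[of _ 0]) simp

instantiation unit_interval :: metric_space
begin

definition dist_unit_interval :: "unit_interval \<Rightarrow> unit_interval \<Rightarrow> real"
  where "dist_unit_interval s t = dist (real_of_ui s) (real_of_ui t)"

definition uniformity_unit_interval :: "(unit_interval \<times> unit_interval) filter"
  where "uniformity_unit_interval = (INF e\<in>{0 <..}. principal {(s, t). dist s t < e})"

definition open_unit_interval :: "unit_interval set \<Rightarrow> bool"
  where "open_unit_interval S = (\<forall>s\<in>S. \<forall>\<^sub>F (s', t) in uniformity. s' = s \<longrightarrow> t \<in> S)"

instance
  by standard
    (auto simp: dist_unit_interval_def uniformity_unit_interval_def open_unit_interval_def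
      real_of_ui_inject dist_triangle2)

end

lemma continuous_on_real_of_ui: "continuous_on UNIV real_of_ui"
  unfolding continuous_on_iff dist_unit_interval_def by blast

lemma continuous_on_ui_of_real: "continuous_on {0..1} ui_of_real"
  unfolding continuous_on_iff by (auto simp: dist_unit_interval_def ui_of_real_inverse)

lemma range_ui_of_real: "ui_of_real ` {0..1} = UNIV"
  using type_definition.Abs_image[OF type_definition_unit_interval] .

lemma compact_UNIV_unit_interval: "compact (UNIV :: unit_interval set)"
  using compact_continuous_image[OF continuous_on_ui_of_real compact_Icc]
  by (simp add: range_ui_of_real)

text \<open>As the unit interval is compact, boundedness is no restriction on its continuous functions,
  and the supremum norm of the type of bounded continuous functions is a maximum;
  see \<open>c01_norm_max\<close> and \<open>c01_representation\<close> below.\<close>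

type_synonym c01 = "unit_interval \<Rightarrow>\<^sub>C real"

lemma continuous_imp_bcontfun:
  fixes f :: "unit_interval \<Rightarrow> real"
  assumes "continuous_on UNIV f"
  shows "f \<in> bcontfun"
  using compact_imp_bounded[OF compact_continuous_image[OF assms compact_UNIV_unit_interval]] assms
  by (simp add: bcontfun_def)

lemma c01_norm_max:
  fixes f :: c01
  shows "(\<exists>x. norm f = \<bar>apply_bcontfun f x\<bar>) \<and> (\<forall>x. \<bar>apply_bcontfun f x\<bar> \<le> norm f)"
proof -
  have "continuous_on UNIV (\<lambda>x. \<bar>apply_bcontfun f x\<bar>)"
    by (intro continuous_intros) auto
  then obtain x where x: "\<And>y. \<bar>apply_bcontfun f y\<bar> \<le> \<bar>apply_bcontfun f x\<bar>"
    using continuous_attains_sup[OF compact_UNIV_unit_interval] by blast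
  have "norm f = \<bar>apply_bcontfun f x\<bar>"
    using norm_bound[of f "\<bar>apply_bcontfun f x\<bar>"] x norm_bounded[of f x] by (simp add: antisym)
  then show ?thesis
    using x by auto
qed

lemma c01_representation:
  fixes h :: "real \<Rightarrow> real"
  assumes "continuous_on {0..1} h"
  shows "\<exists>!f::c01. \<forall>x. apply_bcontfun f x = h (real_of_ui x)"
proof -
  have "continuous_on UNIV (\<lambda>x. h (real_of_ui x))"
    using continuous_on_compose2[OF assms continuous_on_real_of_ui] real_of_ui by blast
  from Bcontfun_inverse[OF continuous_imp_bcontfun[OF this]] show ?thesis
    by (intro ex1I[of _ "Bcontfun (\<lambda>x. h (real_of_ui x))"]) (auto intro: bcontfun_eqI)
qed

definition power_operator :: "nat \<Rightarrow> c01 \<Rightarrow> c01"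
  where "power_operator m f = Bcontfun (\<lambda>x. apply_bcontfun f x ^ m)"

lemma apply_power_operator [simp]:
  "apply_bcontfun (power_operator m f) x = apply_bcontfun f x ^ m"
proof -
  have "continuous_on UNIV (\<lambda>x. apply_bcontfun f x ^ m)"
    by (intro continuous_intros) auto
  then show ?thesis
    by (simp add: power_operator_def Bcontfun_inverse continuous_imp_bcontfun)
qed

end

theory Submission
  imports Defs
begin

text \<open>Pointwise multiplication is a bounded bilinear map on the space of bounded continuous
  functions, so the product rule applies to \<open>f\<^sup>m\<^sup>+\<^sup>1 = f f\<^sup>m\<close> and the formula follows by
  induction on the exponent, starting from the constant map \<open>f\<^sup>0 = 1\<close>.\<close>

definition bcontfun_mult ::
  "('a::topological_space \<Rightarrow>\<^sub>C 'b::real_normed_algebra) \<Rightarrow> ('a \<Rightarrow>\<^sub>C 'b) \<Rightarrow> ('a \<Rightarrow>\<^sub>C 'b)"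
  where "bcontfun_mult f g = Bcontfun (\<lambda>x. apply_bcontfun f x * apply_bcontfun g x)"

text \<open>Used twice: it keeps the pointwise product inside \<open>bcontfun\<close>, and it gives
  the constant 1 in the bilinear bound.\<close>

lemma norm_mult_apply_bcontfun_le:
  fixes f g :: "'a::topological_space \<Rightarrow>\<^sub>C 'b::real_normed_algebra"
  shows "norm (apply_bcontfun f x * apply_bcontfun g x) \<le> norm f * norm g"
  by (rule order_trans[OF norm_mult_ineq]) (intro mult_mono norm_bounded norm_ge_zero)

lemma apply_bcontfun_mult [simp]:
  "apply_bcontfun (bcontfun_mult f g) x = apply_bcontfun f x * apply_bcontfun g x"
proof -
  have "(\<lambda>x. apply_bcontfun f x * apply_bcontfun g x) \<in> bcontfun"
    by (rule bcontfun_normI[OF _ norm_mult_apply_bcontfun_le]) (intro continuous_intros; simp)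
  then show ?thesis
    by (simp add: bcontfun_mult_def Bcontfun_inverse)
qed

lemma bounded_bilinear_bcontfun_mult: "bounded_bilinear bcontfun_mult"
proof
  show "\<exists>K. \<forall>f g. norm (bcontfun_mult f g) \<le> norm f * norm g * K"
    by (rule exI[of _ 1]) (auto intro!: norm_bound norm_mult_apply_bcontfun_le)
qed (auto intro!: bcontfun_eqI simp: algebra_simps)

lemma power_operator_0: "power_operator 0 = (\<lambda>f. const_bcontfun 1)"
  by (auto intro!: bcontfun_eqI)

lemma power_operator_Suc:
  "power_operator (Suc m) = (\<lambda>f. bcontfun_mult f (power_operator m f))"
  by (auto intro!: bcontfun_eqI)

text \<open>Including \<open>m = 0\<close> is harmless: there \<open>m - 1\<close> truncates to 0,
  but the factor \<open>real m\<close> makes the derivative zero, as for a constant map.\<close>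

lemma has_derivative_power_operator:
  "(power_operator m has_derivative
    (\<lambda>g. real m *\<^sub>R bcontfun_mult (power_operator (m - 1) f) g)) (at f)"
proof (induction m)
  case 0
  then show ?case
    by (simp add: power_operator_0)
next
  case (Suc m)
  have "(power_operator (Suc m) has_derivative
      (\<lambda>g. bcontfun_mult f (real m *\<^sub>R bcontfun_mult (power_operator (m - 1) f) g)
        + bcontfun_mult g (power_operator m f))) (at f)"
    unfolding power_operator_Suc
    by (rule bounded_bilinear.FDERIV[OF bounded_bilinear_bcontfun_mult has_derivative_ident Suc.IH])
  moreover have "(\<lambda>g. bcontfun_mult f (real m *\<^sub>R bcontfun_mult (power_operator (m - 1) f) g)
        + bcontfun_mult g (power_operator m f))
      = (\<lambda>g. real (Suc m) *\<^sub>R bcontfun_mult (power_operator (Suc m - 1) f) g)"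
    \<comment> \<open>If \<open>m = 0\<close>, the first summand vanishes; otherwise
      \<open>f * f ^ (m - 1) = f ^ m\<close>, so the summands are \<open>m\<close> copies and one
      copy of \<open>f ^ m * g\<close>.\<close>
    by (cases m) (auto intro!: bcontfun_eqI simp: algebra_simps)
  ultimately show ?case
    by (simp only:)
qed

theorem theorem4p1:
  fixes m :: nat
  assumes "m > 0"
  shows "(\<forall>f::c01. power_operator m differentiable (at f)) \<and>
    (\<forall>(f::c01) (g::c01) (x::unit_interval).
      apply_bcontfun (frechet_derivative (power_operator m) (at f) g) x
        = real m * apply_bcontfun f x ^ (m - 1) * apply_bcontfun g x)"
proof (intro conjI allI)
  fix f :: c01
  show "power_operator m differentiable (at f)"
    using has_derivative_power_operator by (rule differentiableI)
next
  fix f g :: c01 and x :: unit_interval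
  show "apply_bcontfun (frechet_derivative (power_operator m) (at f) g) x
      = real m * apply_bcontfun f x ^ (m - 1) * apply_bcontfun g x"
    \<comment> \<open>\<open>frechet_derivative\<close> is a choice among derivatives; uniqueness at
      a point identifies it with the formula.\<close>
    unfolding frechet_derivative_at[OF has_derivative_power_operator, symmetric] by simp
qed

end
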